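(* For each $w\in(0,\tfrac12)$ there is exactly one root $\alpha=\alpha^\ast(w)\in(0,1)$ of the equation $K_G(w,\alpha)=0$, and it is given by $$\alpha^\ast(w)=\frac{(2w+1)\Big[8w^3+28w^2-2w+1+(2w-1)\sqrt{16w^4+56w^2+1}\,\Big]}{128\,w^3}.$$ Moreover $\alpha^\ast(w)\to1$ as $w\to\tfrac12^-$, and, rounded to four decimal places, $\alpha^\ast(0.1)\approx0.8277$, $\alpha^\ast(0.25)\approx0.9802$, $\alpha^\ast(\tfrac13)\approx0.9959$.
   Context: Let $n=2$, $u:=e^{\theta^1}$, $v:=e^{\theta^2}$, $\Omega:=\{\theta\in\mathbb R^2: u+v<1\}$, $\Psi_+(\theta):=\log(1+u+v)$, $\Psi_-(\theta):=-\log(1-u-v)$, $\Psi_\alpha:=\alpha\Psi_++(1-\alpha)\Psi_-$ for $\alpha\in[0,1]$, and let $g_\alpha:=\operatorname{Hess}_\theta\Psi_\alpha$, a Riemannian metric on $\Omega$. For $0<w<\tfrac12$, $K_G(w,\alpha)$ denotes the Gaussian curvature of $(\Omega,g_\alpha)$ at the point $\theta^1=\theta^2=\log w$. Explicitly $K_G(w,\alpha)=\dfrac{N(w,\alpha)}{4D(w,\alpha)}$ with $$N(w,\alpha)=-128\alpha^2w^3+32\alpha w^4+128\alpha w^3+48\alpha w^2+2\alpha-16w^4-32w^3-24w^2-8w-1,$$ $$D(w,\alpha)=(1+2w-4\alpha w)^2\big[(1+2w)^2-8\alpha w\big].$$ *)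

theory Defs
  imports "HOL-Analysis.Analysis"
begin

section \<open>Gaussian curvature of a metric given in coordinates\<close>

definition partial :: "'n::finite \<Rightarrow> (real^'n \<Rightarrow> real) \<Rightarrow> real^'n \<Rightarrow> real" where
  "partial i f x = deriv (\<lambda>t. f (x + t *\<^sub>R axis i 1)) 0"

definition hessian :: "(real^'n::finite \<Rightarrow> real) \<Rightarrow> real^'n \<Rightarrow> real^'n^'n" where
  "hessian f x = (\<chi> i j. partial i (partial j f) x)"

text \<open>
  Christoffel symbols of the second kind of the Levi-Civita connection,
  \<open>\<Gamma>\<^sup>k\<^sub>i\<^sub>j = 1/2 \<Sum>\<^sub>l g\<^sup>k\<^sup>l (\<partial>\<^sub>i g\<^sub>j\<^sub>l + \<partial>\<^sub>j g\<^sub>i\<^sub>l - \<partial>\<^sub>l g\<^sub>i\<^sub>j)\<close>.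
\<close>

definition christoffel ::
  "(real^'n \<Rightarrow> real^'n^'n) \<Rightarrow> 'n::finite \<Rightarrow> 'n \<Rightarrow> 'n \<Rightarrow> real^'n \<Rightarrow> real" where
  "christoffel g k i j x =
     (1/2) * (\<Sum>l\<in>UNIV. matrix_inv (g x) $ k $ l *
       (partial i (\<lambda>y. g y $ j $ l) x + partial j (\<lambda>y. g y $ i $ l) x
        - partial l (\<lambda>y. g y $ i $ j) x))"

text \<open>
  The index order is \<open>R(\<partial>\<^sub>i, \<partial>\<^sub>j) \<partial>\<^sub>k = \<Sum>\<^sub>l (riemann g l k i j) \<partial>\<^sub>l\<close> with
  \<open>R(X, Y) Z = \<nabla>\<^sub>X \<nabla>\<^sub>Y Z - \<nabla>\<^sub>Y \<nabla>\<^sub>X Z - \<nabla>\<^bsub>[X, Y]\<^esub> Z\<close>.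
\<close>

definition riemann ::
  "(real^'n \<Rightarrow> real^'n^'n) \<Rightarrow> 'n::finite \<Rightarrow> 'n \<Rightarrow> 'n \<Rightarrow> 'n \<Rightarrow> real^'n \<Rightarrow> real" where
  "riemann g l k i j x =
     partial i (christoffel g l j k) x - partial j (christoffel g l i k) x
     + (\<Sum>m\<in>UNIV. christoffel g l i m x * christoffel g m j k x
                  - christoffel g l j m x * christoffel g m i k x)"

text \<open>
  \<open>K = \<langle>R(\<partial>\<^sub>1, \<partial>\<^sub>2) \<partial>\<^sub>2, \<partial>\<^sub>1\<rangle> / det g\<close>; the sign is the one for which round spheres have
  positive curvature.
\<close>

definition gauss_curvature :: "(real^2 \<Rightarrow> real^2^2) \<Rightarrow> real^2 \<Rightarrow> real" where
  "gauss_curvature g x = (\<Sum>l\<in>UNIV. g x $ 1 $ l * riemann g l 2 1 2 x) / det (g x)"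

section \<open>The mixed potentials\<close>

text \<open>
  The potentials and metrics below are total functions on the plane. Only their values
  on the open set \<open>Omega\<close> are meaningful, and curvature at a point of \<open>Omega\<close> depends
  only on the metric near that point.
\<close>

definition Omega :: "(real^2) set" where
  "Omega = {\<theta>. exp (\<theta> $ 1) + exp (\<theta> $ 2) < 1}"

definition Psi_plus :: "real^2 \<Rightarrow> real" where
  "Psi_plus \<theta> = ln (1 + exp (\<theta> $ 1) + exp (\<theta> $ 2))"

definition Psi_minus :: "real^2 \<Rightarrow> real" where
  "Psi_minus \<theta> = - ln (1 - exp (\<theta> $ 1) - exp (\<theta> $ 2))"

definition Psi :: "real \<Rightarrow> real^2 \<Rightarrow> real" where
  "Psi \<alpha> \<theta> = \<alpha> * Psi_plus \<theta> + (1 - \<alpha>) * Psi_minus \<theta>"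

definition g_metric :: "real \<Rightarrow> real^2 \<Rightarrow> real^2^2" where
  "g_metric \<alpha> = hessian (Psi \<alpha>)"

definition diag_point :: "real \<Rightarrow> real^2" where
  "diag_point w = (\<chi> i. ln w)"

definition K_G :: "real \<Rightarrow> real \<Rightarrow> real" where
  "K_G w \<alpha> = gauss_curvature (g_metric \<alpha>) (diag_point w)"

lemma open_Omega: "open Omega"
  unfolding Omega_def by (intro open_Collect_less continuous_intros)

lemma diag_point_in_Omega: "0 < w \<Longrightarrow> w < 1/2 \<Longrightarrow> diag_point w \<in> Omega"
  by (simp add: Omega_def diag_point_def)

definition alpha_star :: "real \<Rightarrow> real" where
  "alpha_star w = (THE \<alpha>. 0 < \<alpha> \<and> \<alpha> < 1 \<and> K_G w \<alpha> = 0)"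

end

theory Submission
  imports Defs
begin

text \<open>
  For a Hessian metric \<open>\<partial>\<^sub>k g\<^sub>i\<^sub>j\<close> is totally symmetric, so lowering the upper index of
  \<open>\<Gamma>\<^sup>k\<^sub>i\<^sub>j\<close> gives half a third derivative of the potential. The fourth derivatives cancel in
  the curvature, which is therefore a rational function of second and third derivatives.
  The potential here depends only on \<open>s = u + v\<close>; with \<open>h\<close> its derivative in \<open>s\<close>, the
  curvature on the diagonal is
  \<open>- (h h' + s h h'' - s h'\<^sup>2) / (4 h\<^sup>2 (h + s h'))\<close>, whose numerator is, up to a positive
  factor, a concave quadratic in \<open>\<alpha>\<close> that is negative at \<open>0\<close> and equals \<open>(1 - 2 w)\<^sup>4 > 0\<close>
  at \<open>1\<close>. Hence exactly one of its two roots lies in \<open>(0, 1)\<close>.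
\<close>

section \<open>Partial derivatives and metrics with totally symmetric derivative\<close>

text \<open>A relation rather than the value \<open>partial\<close>: \<open>deriv\<close> denotes
  some number even where no derivative exists, so differentiability is carried along
  explicitly.\<close>

definition has_partial :: "'n::finite \<Rightarrow> (real^'n \<Rightarrow> real) \<Rightarrow> real \<Rightarrow> real^'n \<Rightarrow> bool" where
  "has_partial i f d x \<longleftrightarrow> ((\<lambda>t. f (x + t *\<^sub>R axis i 1)) has_field_derivative d) (at 0)"

lemma has_partial_imp_partial: "has_partial i f d x \<Longrightarrow> partial i f x = d"
  unfolding has_partial_def partial_def by (rule DERIV_imp_deriv)

lemma eventually_on_line:
  fixes x :: "real^'n::finite"
  assumes "open S" "x \<in> S"
  shows "eventually (\<lambda>t. x + t *\<^sub>R axis i 1 \<in> S) (nhds 0)"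
proof -
  have "continuous_on UNIV (\<lambda>t::real. x + t *\<^sub>R axis i 1)"
    by (intro continuous_intros)
  then have "open ((\<lambda>t::real. x + t *\<^sub>R axis i 1) -` S)"
    using assms(1) by (simp add: continuous_on_open_vimage)
  then show ?thesis
    using assms(2) by (auto simp: eventually_nhds intro!: exI[of _ "(\<lambda>t::real. x + t *\<^sub>R axis i 1) -` S"])
qed

text \<open>A coordinate line stays in an open set for small \<open>t\<close>, so agreement on the
  set is enough. This lets closed forms valid only on \<open>Omega\<close> be differentiated
  there.\<close>

lemma has_partial_transform:
  assumes "has_partial i g d x" "open S" "x \<in> S" "\<And>y. y \<in> S \<Longrightarrow> f y = g y"
  shows "has_partial i f d x"
proof -
  have "eventually (\<lambda>t. f (x + t *\<^sub>R axis i 1) = g (x + t *\<^sub>R axis i 1)) (nhds 0)"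
    using eventually_on_line[OF assms(2,3)] by (rule eventually_mono) (rule assms(4))
  from DERIV_cong_ev[OF refl this refl] show ?thesis
    using assms(1) unfolding has_partial_def by blast
qed

lemma partial_cong_open:
  assumes "open S" "x \<in> S" "\<And>y. y \<in> S \<Longrightarrow> f y = g y"
  shows "partial i f x = partial i g x"
  unfolding partial_def
  by (rule deriv_cong_ev)
    (auto intro!: eventually_mono[OF eventually_on_line[OF assms(1,2)]] assms(3))

lemma has_partial_const: "has_partial i (\<lambda>y. c) 0 x"
  and has_partial_add: "has_partial i f d x \<Longrightarrow> has_partial i g e x \<Longrightarrow>
    has_partial i (\<lambda>y. f y + g y) (d + e) x"
  and has_partial_diff: "has_partial i f d x \<Longrightarrow> has_partial i g e x \<Longrightarrow>
    has_partial i (\<lambda>y. f y - g y) (d - e) x"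
  and has_partial_mult: "has_partial i f d x \<Longrightarrow> has_partial i g e x \<Longrightarrow>
    has_partial i (\<lambda>y. f y * g y) (d * g x + f x * e) x"
  and has_partial_divide: "has_partial i f d x \<Longrightarrow> has_partial i g e x \<Longrightarrow> g x \<noteq> 0 \<Longrightarrow>
    has_partial i (\<lambda>y. f y / g y) ((d * g x - f x * e) / (g x * g x)) x"
  and has_partial_chain: "has_partial i f d x \<Longrightarrow> (F has_field_derivative D) (at (f x)) \<Longrightarrow>
    has_partial i (\<lambda>y. F (f y)) (D * d) x"
  unfolding has_partial_def
  by (auto intro!: derivative_eq_intros DERIV_chain2[of F])

lemma has_partial_exp_component:
  "has_partial k (\<lambda>y. exp (y $ i)) (if i = k then exp (x $ i) else 0) x"
  unfolding has_partial_def
  by (auto intro!: derivative_eq_intros simp: axis_def)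

section \<open>Christoffel symbols and curvature of plane metrics with symmetric derivative\<close>

lemma matrix_inv_unique_real:
  fixes A B :: "real^'n^'n"
  assumes "A ** B = mat 1"
  shows "matrix_inv A = B"
proof -
  have "A ** matrix_inv A = mat 1 \<and> matrix_inv A ** A = mat 1"
    unfolding matrix_inv_def
    by (rule someI[of _ B]) (use assms matrix_left_right_inverse in auto)
  then show ?thesis
    by (metis assms matrix_mul_assoc matrix_mul_lid matrix_mul_rid)
qed

lemma matrix_inv_2:
  fixes A :: "real^2^2"
  assumes "det A \<noteq> 0"
  shows "matrix_inv A = vector [vector [A$2$2 / det A, - A$1$2 / det A],
                                vector [- A$2$1 / det A, A$1$1 / det A]]"
proof (rule matrix_inv_unique_real)
  have "A$1$1 * A$2$2 - A$1$2 * A$2$1 \<noteq> 0"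
    using assms by (simp add: det_2)
  then show "A ** vector [vector [A$2$2 / det A, - A$1$2 / det A],
                          vector [- A$2$1 / det A, A$1$1 / det A]] = mat 1"
    by (simp add: vec_eq_iff forall_2 matrix_matrix_mult_def sum_2 mat_def det_2
        mult.commute flip: diff_divide_distrib)
qed

text \<open>The symmetry of \<open>T\<close>, the derivative of the metric, is the Codazzi condition
  for the flat coordinate connection; Hessian metrics satisfy it because third derivatives
  commute.\<close>

locale codazzi_metric =
  fixes S :: "(real^2) set" and g :: "real^2 \<Rightarrow> real^2^2"
    and T :: "2 \<Rightarrow> 2 \<Rightarrow> 2 \<Rightarrow> real^2 \<Rightarrow> real"
  assumes open_S: "open S"
    and det_nz: "y \<in> S \<Longrightarrow> det (g y) \<noteq> 0"
    and g_sym: "y \<in> S \<Longrightarrow> g y $ i $ j = g y $ j $ i"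
    and g_partial: "y \<in> S \<Longrightarrow> has_partial k (\<lambda>z. g z $ i $ j) (T i j k y) y"
    and T_sym: "T i j k = T j i k" "T i j k = T i k j"
begin

text \<open>By the symmetry of \<open>T\<close> the three metric derivatives collapse to the single
  term \<open>T i j l\<close>; the adjugate supplies the inverse metric.\<close>

lemma christoffel_eq:
  assumes y: "y \<in> S"
  shows "christoffel g 1 i j y = (g y $ 2 $ 2 * T i j 1 y - g y $ 1 $ 2 * T i j 2 y) / (2 * det (g y))"
    and "christoffel g 2 i j y = (g y $ 1 $ 1 * T i j 2 y - g y $ 1 $ 2 * T i j 1 y) / (2 * det (g y))"
proof -
  have gk: "partial i (\<lambda>z. g z $ j $ l) y + partial j (\<lambda>z. g z $ i $ l) y
      - partial l (\<lambda>z. g z $ i $ j) y = T i j l y" for l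
    using T_sym by (simp add: has_partial_imp_partial[OF g_partial[OF y]])
  show "christoffel g 1 i j y = (g y $ 2 $ 2 * T i j 1 y - g y $ 1 $ 2 * T i j 2 y) / (2 * det (g y))"
    unfolding christoffel_def gk matrix_inv_2[OF det_nz[OF y]]
    by (simp add: sum_2 diff_divide_distrib)
  show "christoffel g 2 i j y = (g y $ 1 $ 1 * T i j 2 y - g y $ 1 $ 2 * T i j 1 y) / (2 * det (g y))"
    unfolding christoffel_def gk matrix_inv_2[OF det_nz[OF y]]
    by (simp add: sum_2 diff_divide_distrib g_sym[OF y, of 2 1])
qed

lemma lower_christoffel:
  assumes y: "y \<in> S"
  shows "g y $ 1 $ 1 * christoffel g 1 i j y + g y $ 1 $ 2 * christoffel g 2 i j y = T i j 1 y / 2"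
proof -
  have d: "det (g y) = g y $ 1 $ 1 * g y $ 2 $ 2 - g y $ 1 $ 2 * g y $ 1 $ 2"
    by (simp add: det_2 g_sym[OF y, of 2 1])
  have nz: "det (g y) \<noteq> 0"
    by (rule det_nz[OF y])
  show "g y $ 1 $ 1 * christoffel g 1 i j y + g y $ 1 $ 2 * christoffel g 2 i j y = T i j 1 y / 2"
    unfolding christoffel_eq[OF y] using nz
    by (simp add: divide_simps) (simp add: d algebra_simps)
qed

text \<open>Provides the differentiability that the product rule for the lowered symbol requires;
  the explicit value of the derivative is immaterial.\<close>

lemma christoffel_has_partial:
  assumes x: "x \<in> S" and T: "\<And>l. \<exists>d. has_partial m (T i j l) d x"
  shows "has_partial m (christoffel g k i j) (partial m (christoffel g k i j) x) x"
proof -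
  obtain d1 d2 where d: "has_partial m (T i j 1) d1 x" "has_partial m (T i j 2) d2 x"
    using T by blast
  define e where "e = 2 * (T 1 1 m x * g x $ 2 $ 2 + g x $ 1 $ 1 * T 2 2 m x
                   - (T 1 2 m x * g x $ 2 $ 1 + g x $ 1 $ 2 * T 2 1 m x))"
  have det: "has_partial m (\<lambda>y. 2 * det (g y)) e x"
    unfolding e_def det_2
    using has_partial_mult[OF has_partial_const[of _ 2] has_partial_diff[OF
       has_partial_mult[OF g_partial[OF x] g_partial[OF x]]
       has_partial_mult[OF g_partial[OF x] g_partial[OF x]]]]
    by simp
  have "k = 1 \<or> k = 2" by (rule exhaust_2)
  then have "\<exists>d. has_partial m (christoffel g k i j) d x"
  proof
    assume k: "k = 1"
    have "has_partial m (\<lambda>y. (g y $ 2 $ 2 * T i j 1 y - g y $ 1 $ 2 * T i j 2 y) / (2 * det (g y)))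
      (((T 2 2 m x * T i j 1 x + g x $ 2 $ 2 * d1 - (T 1 2 m x * T i j 2 x + g x $ 1 $ 2 * d2)) * (2 * det (g x))
        - (g x $ 2 $ 2 * T i j 1 x - g x $ 1 $ 2 * T i j 2 x) * e) / (2 * det (g x) * (2 * det (g x)))) x"
      using det_nz[OF x]
      by (intro has_partial_divide has_partial_diff det) (auto intro!: has_partial_mult g_partial x d)
    from has_partial_transform[OF this open_S x, of "christoffel g 1 i j"] christoffel_eq(1)
    show ?thesis
      unfolding k by blast
  next
    assume k: "k = 2"
    have "has_partial m (\<lambda>y. (g y $ 1 $ 1 * T i j 2 y - g y $ 1 $ 2 * T i j 1 y) / (2 * det (g y)))
      (((T 1 1 m x * T i j 2 x + g x $ 1 $ 1 * d2 - (T 1 2 m x * T i j 1 x + g x $ 1 $ 2 * d1)) * (2 * det (g x))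
        - (g x $ 1 $ 1 * T i j 2 x - g x $ 1 $ 2 * T i j 1 x) * e) / (2 * det (g x) * (2 * det (g x)))) x"
      using det_nz[OF x]
      by (intro has_partial_divide has_partial_diff det) (auto intro!: has_partial_mult g_partial x d)
    from has_partial_transform[OF this open_S x, of "christoffel g 2 i j"] christoffel_eq(2)
    show ?thesis
      unfolding k by blast
  qed
  then show ?thesis
    by (auto dest: has_partial_imp_partial)
qed

text \<open>
  Differentiating the lowered symbol \<open>T\<^sub>i\<^sub>j\<^sub>1 / 2\<close> avoids differentiating the inverse metric.
\<close>

lemma lower_partial_christoffel:
  assumes x: "x \<in> S" and T: "\<And>l. \<exists>d. has_partial m (T i j l) d x"
  shows "g x $ 1 $ 1 * partial m (christoffel g 1 i j) x
       + g x $ 1 $ 2 * partial m (christoffel g 2 i j) x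
       = partial m (T i j 1) x / 2
         - T 1 1 m x * christoffel g 1 i j x - T 1 2 m x * christoffel g 2 i j x"
proof -
  have "has_partial m (\<lambda>y. T i j 1 y * (1 / 2)) (partial m (T i j 1) x * (1 / 2)) x"
    using T[of 1] has_partial_mult[OF _ has_partial_const[of m "1/2" x], of "T i j 1"]
    by (auto dest: has_partial_imp_partial)
  then have "has_partial m (\<lambda>y. g y $ 1 $ 1 * christoffel g 1 i j y + g y $ 1 $ 2 * christoffel g 2 i j y)
      (partial m (T i j 1) x * (1 / 2)) x"
    by (rule has_partial_transform[OF _ open_S x]) (simp add: lower_christoffel)
  moreover have "has_partial m (\<lambda>y. g y $ 1 $ 1 * christoffel g 1 i j y + g y $ 1 $ 2 * christoffel g 2 i j y)
      (T 1 1 m x * christoffel g 1 i j x + g x $ 1 $ 1 * partial m (christoffel g 1 i j) x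
      + (T 1 2 m x * christoffel g 2 i j x + g x $ 1 $ 2 * partial m (christoffel g 2 i j) x)) x"
    by (intro has_partial_add has_partial_mult g_partial christoffel_has_partial x T)
  ultimately show ?thesis
    by (auto dest!: has_partial_imp_partial)
qed

text \<open>In the Hessian case \<open>Q\<close> is a mixed fourth derivative of the potential. It
  enters both derivative terms of the curvature equally and cancels.\<close>

lemma gauss_curvature_eq:
  assumes x: "x \<in> S"
    and Q: "has_partial 1 (T 1 2 2) Q x" "has_partial 2 (T 1 1 2) Q x"
    and T: "\<exists>d. has_partial 1 (T 2 2 2) d x" "\<exists>d. has_partial 2 (T 1 2 2) d x"
  shows "gauss_curvature g x =
    - (g x $ 2 $ 2 * (T 1 1 1 x * T 1 2 2 x - (T 1 1 2 x)^2)
       - g x $ 1 $ 2 * (T 1 1 1 x * T 2 2 2 x - T 1 1 2 x * T 1 2 2 x)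
       + g x $ 1 $ 1 * (T 1 1 2 x * T 2 2 2 x - (T 1 2 2 x)^2)) / (4 * (det (g x))^2)"
proof -
  have s: "T 2 2 1 = T 1 2 2" "T 1 2 1 = T 1 1 2" "T 2 1 1 = T 1 1 2" "T 2 1 2 = T 1 2 2"
    using T_sym by metis+
  have T1: "\<exists>d. has_partial 1 (T 2 2 l) d x" for l
    using exhaust_2[of l] Q(1) T(1) s by auto
  have T2: "\<exists>d. has_partial 2 (T 1 2 l) d x" for l
    using exhaust_2[of l] Q(2) T(2) s by auto
  have nz: "det (g x) \<noteq> 0"
    by (rule det_nz[OF x])
  define A B C where "A = (\<lambda>k. christoffel g k 2 2 x)" and "B = (\<lambda>k. christoffel g k 1 2 x)"
    and "C = (\<lambda>k. christoffel g k 1 1 x)"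
  have B': "christoffel g k 2 1 x = B k" for k
    unfolding B_def using exhaust_2[of k] s by (auto simp: christoffel_eq[OF x])
  define X where "X = (\<lambda>l. partial 1 (christoffel g l 2 2) x)"
  define Y where "Y = (\<lambda>l. partial 2 (christoffel g l 1 2) x)"
  have XY: "g x $ 1 $ 1 * X 1 + g x $ 1 $ 2 * X 2 = Q / 2 - T 1 1 1 x * A 1 - T 1 1 2 x * A 2"
    "g x $ 1 $ 1 * Y 1 + g x $ 1 $ 2 * Y 2 = Q / 2 - T 1 1 2 x * B 1 - T 1 2 2 x * B 2"
    using lower_partial_christoffel[OF x T1] lower_partial_christoffel[OF x T2]
    by (simp_all add: s X_def Y_def A_def B_def has_partial_imp_partial[OF Q(1)]
        has_partial_imp_partial[OF Q(2)])
  have low: "g x $ 1 $ 1 * A 1 + g x $ 1 $ 2 * A 2 = T 1 2 2 x / 2"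
    "g x $ 1 $ 1 * B 1 + g x $ 1 $ 2 * B 2 = T 1 1 2 x / 2"
    "g x $ 1 $ 1 * C 1 + g x $ 1 $ 2 * C 2 = T 1 1 1 x / 2"
    unfolding A_def B_def C_def using lower_christoffel[OF x] s by auto
  \<comment> \<open>Contracting with the first row of the metric groups the terms into the
    combinations evaluated by \<open>XY\<close> and \<open>low\<close>.\<close>
  have "(\<Sum>l\<in>UNIV. g x $ 1 $ l * riemann g l 2 1 2 x)
    = (g x $ 1 $ 1 * X 1 + g x $ 1 $ 2 * X 2) - (g x $ 1 $ 1 * Y 1 + g x $ 1 $ 2 * Y 2)
      + (g x $ 1 $ 1 * C 1 + g x $ 1 $ 2 * C 2) * A 1 + (g x $ 1 $ 1 * B 1 + g x $ 1 $ 2 * B 2) * A 2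
      - (g x $ 1 $ 1 * B 1 + g x $ 1 $ 2 * B 2) * B 1 - (g x $ 1 $ 1 * A 1 + g x $ 1 $ 2 * A 2) * B 2"
    unfolding riemann_def sum_2 B'
    unfolding A_def B_def C_def X_def Y_def
    by (simp add: algebra_simps)
  \<comment> \<open>\<open>Q\<close> cancels; the products coming from \<open>low\<close> have the
    opposite sign and half the size of those from \<open>XY\<close>, so half of the latter
    remains.\<close>
  also have "\<dots> = - (T 1 1 1 x * A 1 + T 1 1 2 x * A 2 - T 1 1 2 x * B 1 - T 1 2 2 x * B 2) / 2"
    unfolding XY low by (simp add: field_simps)
  also have "\<dots> = - (g x $ 2 $ 2 * (T 1 1 1 x * T 1 2 2 x - (T 1 1 2 x)^2)
       - g x $ 1 $ 2 * (T 1 1 1 x * T 2 2 2 x - T 1 1 2 x * T 1 2 2 x)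
       + g x $ 1 $ 1 * (T 1 1 2 x * T 2 2 2 x - (T 1 2 2 x)^2)) / (4 * det (g x))"
    unfolding A_def B_def christoffel_eq[OF x] s using nz
    by (simp add: divide_simps) (simp add: algebra_simps power2_eq_square)
  finally show ?thesis
    unfolding gauss_curvature_def by (simp add: power2_eq_square)
qed

end

section \<open>The Hessian metric of \<open>Psi\<close>\<close>

text \<open>
  \<open>Psi \<alpha> = \<phi> (u + v)\<close> with \<open>\<phi> s = \<alpha> ln (1 + s) - (1 - \<alpha>) ln (1 - s)\<close>; \<open>hderiv \<alpha> m\<close> is the
  derivative of order \<open>m + 1\<close> of \<open>\<phi>\<close>.
\<close>

definition hderiv :: "real \<Rightarrow> nat \<Rightarrow> real \<Rightarrow> real" where
  "hderiv \<alpha> m s = fact m * ((- 1) ^ m * \<alpha> / (1 + s) ^ Suc m + (1 - \<alpha>) / (1 - s) ^ Suc m)"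

definition expsum :: "real^2 \<Rightarrow> real" where
  "expsum y = exp (y $ 1) + exp (y $ 2)"

text \<open>One rule for both \<open>1 + s\<close> and \<open>1 - s\<close>, with
  \<open>b = 1\<close> and \<open>b = - 1\<close>. The result keeps its shape with \<open>m\<close>
  raised by one, which yields the recursion for \<open>hderiv\<close>.\<close>

lemma DERIV_divide_power:
  fixes a b c s :: real
  assumes "a + b * s \<noteq> 0"
  shows "((\<lambda>s. c / (a + b * s) ^ Suc m) has_field_derivative
    - (real (Suc m) * b * c) / (a + b * s) ^ Suc (Suc m)) (at s)"
proof -
  define y where "y = a + b * s"
  have "((\<lambda>s. c / (a + b * s) ^ Suc m) has_field_derivative
    - (c * (real (Suc m) * b * y ^ m)) / (y ^ Suc m * y ^ Suc m)) (at s)"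
    using assms unfolding y_def
    by (auto intro!: derivative_eq_intros simp del: power_Suc of_nat_Suc)
  moreover have "- (c * (real (Suc m) * b * y ^ m)) / (y ^ Suc m * y ^ Suc m)
    = - (real (Suc m) * b * c) / y ^ Suc (Suc m)"
    using assms by (simp add: y_def[symmetric] divide_simps del: of_nat_Suc)
  ultimately show ?thesis
    unfolding y_def by simp
qed

lemma DERIV_hderiv:
  assumes "0 < s" "s < 1"
  shows "(hderiv \<alpha> m has_field_derivative hderiv \<alpha> (Suc m) s) (at s)"
proof -
  have "((\<lambda>s. fact m * ((- 1) ^ m * \<alpha> / (1 + 1 * s) ^ Suc m + (1 - \<alpha>) / (1 + (- 1) * s) ^ Suc m))
      has_field_derivative fact m * (- (real (Suc m) * 1 * ((- 1) ^ m * \<alpha>)) / (1 + 1 * s) ^ Suc (Suc m)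
        + - (real (Suc m) * (- 1) * (1 - \<alpha>)) / (1 + (- 1) * s) ^ Suc (Suc m))) (at s)"
    using assms by (intro DERIV_cmult DERIV_add DERIV_divide_power) auto
  moreover have "(\<lambda>s. fact m * ((- 1) ^ m * \<alpha> / (1 + 1 * s) ^ Suc m + (1 - \<alpha>) / (1 + (- 1) * s) ^ Suc m))
      = hderiv \<alpha> m"
    by (simp add: fun_eq_iff hderiv_def)
  moreover have "fact m * (- (real (Suc m) * 1 * ((- 1) ^ m * \<alpha>)) / (1 + 1 * s) ^ Suc (Suc m)
        + - (real (Suc m) * (- 1) * (1 - \<alpha>)) / (1 + (- 1) * s) ^ Suc (Suc m)) = hderiv \<alpha> (Suc m) s"
    (is "fact m * (- (?r * 1 * (?e * \<alpha>)) / ?p + - (?r * (- 1) * (1 - \<alpha>)) / ?q) = _")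
  proof -
    have "fact m * (- (?r * 1 * (?e * \<alpha>)) / ?p + - (?r * (- 1) * (1 - \<alpha>)) / ?q)
      = ?r * fact m * (- ?e * \<alpha> / ?p + (1 - \<alpha>) / ?q)"
      by (simp only: minus_mult_left[symmetric] minus_mult_right[symmetric] minus_minus mult_1_right
          minus_divide_left[symmetric] distrib_left times_divide_eq_right)
        (simp only: mult_ac mult_minus_right mult_minus_left)
    then show ?thesis by (simp add: hderiv_def)
  qed
  ultimately show ?thesis
    by simp
qed

lemma Omega_expsum: "y \<in> Omega \<Longrightarrow> 0 < expsum y \<and> expsum y < 1"
  by (simp add: Omega_def expsum_def add_pos_pos)

text \<open>Lets the differentiation rules build the derivative as an unknown, to be compared with
  the intended closed form afterwards.\<close>

lemma has_partial_eq: "has_partial i f d x \<Longrightarrow> d = e \<Longrightarrow> has_partial i f e x"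
  by simp

lemma has_partial_expsum: "has_partial k expsum (exp (y $ k)) y"
  unfolding expsum_def
  by (rule has_partial_eq[OF has_partial_add[OF has_partial_exp_component has_partial_exp_component]])
    (use exhaust_2[of k] in auto)

lemma has_partial_hderiv:
  "y \<in> Omega \<Longrightarrow> has_partial k (\<lambda>z. hderiv \<alpha> m (expsum z)) (hderiv \<alpha> (Suc m) (expsum y) * exp (y $ k)) y"
  using has_partial_chain[OF has_partial_expsum DERIV_hderiv] Omega_expsum by blast

lemma has_partial_Psi:
  assumes "y \<in> Omega"
  shows "has_partial j (Psi \<alpha>) (exp (y $ j) * hderiv \<alpha> 0 (expsum y)) y"
proof -
  have s: "0 < expsum y" "expsum y < 1" using Omega_expsum[OF assms] by auto
  have Psi: "Psi \<alpha> = (\<lambda>z. \<alpha> * ln (1 + expsum z) + (1 - \<alpha>) * - ln (1 - expsum z))"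
    by (simp add: fun_eq_iff Psi_def Psi_plus_def Psi_minus_def expsum_def algebra_simps)
  have "((\<lambda>t. \<alpha> * ln (1 + t) + (1 - \<alpha>) * - ln (1 - t)) has_field_derivative
      hderiv \<alpha> 0 (expsum y)) (at (expsum y))"
    using s by (auto intro!: derivative_eq_intros simp: hderiv_def)
  from has_partial_chain[OF has_partial_expsum this] show ?thesis
    unfolding Psi by (simp add: mult.commute)
qed

text \<open>The second partials by the product rule; the diagonal term appears because
  \<open>exp (y $ j)\<close> depends on the coordinate \<open>j\<close> alone.\<close>

definition Psi2 :: "real \<Rightarrow> 2 \<Rightarrow> 2 \<Rightarrow> real^2 \<Rightarrow> real" where
  "Psi2 \<alpha> i j y = of_bool (i = j) * (exp (y $ j) * hderiv \<alpha> 0 (expsum y))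
     + exp (y $ i) * exp (y $ j) * hderiv \<alpha> 1 (expsum y)"

definition Psi3 :: "real \<Rightarrow> 2 \<Rightarrow> 2 \<Rightarrow> 2 \<Rightarrow> real^2 \<Rightarrow> real" where
  "Psi3 \<alpha> i j k y = of_bool (i = j \<and> j = k) * (exp (y $ j) * hderiv \<alpha> 0 (expsum y))
     + (of_bool (i = j) * (exp (y $ i) * exp (y $ k)) + of_bool (i = k) * (exp (y $ i) * exp (y $ j))
        + of_bool (j = k) * (exp (y $ i) * exp (y $ j))) * hderiv \<alpha> 1 (expsum y)
     + exp (y $ i) * exp (y $ j) * exp (y $ k) * hderiv \<alpha> 2 (expsum y)"

lemmas has_partial_intros = has_partial_const has_partial_add has_partial_mult
  has_partial_exp_component has_partial_hderiv

lemma g_metric_Omega: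
  assumes "y \<in> Omega"
  shows "g_metric \<alpha> y $ i $ j = Psi2 \<alpha> i j y"
proof -
  have "partial i (partial j (Psi \<alpha>)) y = partial i (\<lambda>z. exp (z $ j) * hderiv \<alpha> 0 (expsum z)) y"
    by (rule partial_cong_open[OF open_Omega assms has_partial_imp_partial[OF has_partial_Psi]])
  also have "\<dots> = Psi2 \<alpha> i j y"
    by (rule has_partial_imp_partial[OF has_partial_eq])
      ((rule has_partial_intros assms)+, auto simp: Psi2_def algebra_simps)
  finally show ?thesis
    by (simp add: g_metric_def hessian_def)
qed

lemma has_partial_Psi2:
  assumes "y \<in> Omega"
  shows "has_partial k (Psi2 \<alpha> i j) (Psi3 \<alpha> i j k y) y"
  unfolding Psi2_def
  by (rule has_partial_eq, (rule has_partial_intros assms)+)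
    (auto simp: Psi3_def algebra_simps numeral_2_eq_2)

lemma has_partial_Psi3_ex: "y \<in> Omega \<Longrightarrow> \<exists>d. has_partial m (Psi3 \<alpha> i j k) d y"
  unfolding Psi3_def by (rule exI, (rule has_partial_intros | assumption)+)

text \<open>Both are the derivative of \<open>Psi \<alpha>\<close> taken twice in each coordinate,
  so they share the value \<open>Q\<close>.\<close>

lemma has_partial_Psi3_mixed:
  fixes \<alpha> :: real
  assumes "y \<in> Omega"
  defines "Q \<equiv> exp (y $ 1) * exp (y $ 2) * hderiv \<alpha> 1 (expsum y)
    + exp (y $ 1) * exp (y $ 2) * (exp (y $ 1) + exp (y $ 2)) * hderiv \<alpha> 2 (expsum y)
    + (exp (y $ 1) * exp (y $ 2))^2 * hderiv \<alpha> 3 (expsum y)"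
  shows "has_partial 1 (Psi3 \<alpha> 1 2 2) Q y" "has_partial 2 (Psi3 \<alpha> 1 1 2) Q y"
  unfolding Psi3_def
  by (rule has_partial_eq, (rule has_partial_intros assms(1))+,
      simp add: Q_def algebra_simps numeral_2_eq_2 numeral_3_eq_3)+

text \<open>Both quantities are factors of the determinant of the metric. The second is the
  derivative of \<open>s * hderiv \<alpha> 0 s\<close>, hence a convex combination of
  \<open>1 / (1 + s)^2\<close> and \<open>1 / (1 - s)^2\<close>.\<close>

lemma hderiv_pos:
  assumes "0 < s" "s < 1" "0 \<le> \<alpha>" "\<alpha> \<le> 1"
  shows "0 < hderiv \<alpha> 0 s" "0 < hderiv \<alpha> 0 s + s * hderiv \<alpha> 1 s"
proof -
  have pos: "0 < \<alpha> * a + (1 - \<alpha>) * b" if "0 < a" "0 < b" for a b :: real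
    using assms that by (cases "\<alpha> = 0") (auto intro: add_pos_nonneg)
  show "0 < hderiv \<alpha> 0 s"
    using pos[of "1 / (1 + s)" "1 / (1 - s)"] assms by (simp add: hderiv_def)
  have "hderiv \<alpha> 0 s + s * hderiv \<alpha> 1 s = \<alpha> * (1 / (1 + s)^2) + (1 - \<alpha>) * (1 / (1 - s)^2)"
    using assms(1,2) by (simp add: hderiv_def divide_simps power2_eq_square) (simp add: algebra_simps)
  then show "0 < hderiv \<alpha> 0 s + s * hderiv \<alpha> 1 s"
    using pos[of "1 / (1 + s)^2" "1 / (1 - s)^2"] assms by simp
qed

text \<open>The metric is a diagonal matrix plus \<open>hderiv \<alpha> 1\<close> times the outer
  square of the vector of exponentials; this rank-one term makes the determinant linear in
  \<open>hderiv \<alpha> 1\<close>.\<close>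

lemma det_g_metric:
  assumes "y \<in> Omega"
  shows "det (g_metric \<alpha> y) = exp (y $ 1) * exp (y $ 2) * hderiv \<alpha> 0 (expsum y)
    * (hderiv \<alpha> 0 (expsum y) + expsum y * hderiv \<alpha> 1 (expsum y))"
  unfolding det_2 g_metric_Omega[OF assms] Psi2_def
  by (simp add: algebra_simps) (simp add: expsum_def algebra_simps)

lemma codazzi_g_metric:
  assumes "0 \<le> \<alpha>" "\<alpha> \<le> 1"
  shows "codazzi_metric Omega (g_metric \<alpha>) (Psi3 \<alpha>)"
proof
  fix y i j k assume y: "y \<in> Omega"
  show "det (g_metric \<alpha> y) \<noteq> 0"
    using hderiv_pos[OF _ _ assms, of "expsum y"] Omega_expsum[OF y] by (simp add: det_g_metric[OF y])
  show "g_metric \<alpha> y $ i $ j = g_metric \<alpha> y $ j $ i"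
    by (auto simp: g_metric_Omega[OF y] Psi2_def)
  show "has_partial k (\<lambda>z. g_metric \<alpha> z $ i $ j) (Psi3 \<alpha> i j k y) y"
    by (rule has_partial_transform[OF has_partial_Psi2[OF y] open_Omega y]) (rule g_metric_Omega)
qed (auto simp: fun_eq_iff Psi3_def open_Omega)

section \<open>Curvature at the diagonal points as a rational function of \<open>w\<close> and
  \<open>\<alpha>\<close>\<close>

lemma K_G_hderiv:
  assumes w: "0 < w" "w < 1/2" and \<alpha>: "0 \<le> \<alpha>" "\<alpha> \<le> 1"
  defines "h \<equiv> \<lambda>m. hderiv \<alpha> m (2 * w)"
  shows "K_G w \<alpha> = - (h 0 * h 1 + 2 * w * h 0 * h 2 - 2 * w * (h 1)^2)
    / (4 * (h 0)^2 * (h 0 + 2 * w * h 1))"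
proof -
  interpret codazzi_metric Omega "g_metric \<alpha>" "Psi3 \<alpha>"
    by (rule codazzi_g_metric[OF \<alpha>])
  have x: "diag_point w \<in> Omega"
    by (rule diag_point_in_Omega[OF w])
  have u: "exp (diag_point w $ i) = w" for i
    using w by (simp add: diag_point_def)
  have s: "expsum (diag_point w) = 2 * w"
    by (simp add: expsum_def u)
  have pos: "h 0 > 0" "h 0 + 2 * w * h 1 > 0"
    unfolding h_def using hderiv_pos[of "2 * w" \<alpha>] w \<alpha> by auto
  have [simp]: "g_metric \<alpha> (diag_point w) $ 1 $ 1 = w * h 0 + w^2 * h 1"
    "g_metric \<alpha> (diag_point w) $ 2 $ 2 = w * h 0 + w^2 * h 1"
    "g_metric \<alpha> (diag_point w) $ 1 $ 2 = w^2 * h 1"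
    "Psi3 \<alpha> 1 1 1 (diag_point w) = w * h 0 + 3 * w^2 * h 1 + w^3 * h 2"
    "Psi3 \<alpha> 2 2 2 (diag_point w) = w * h 0 + 3 * w^2 * h 1 + w^3 * h 2"
    "Psi3 \<alpha> 1 1 2 (diag_point w) = w^2 * h 1 + w^3 * h 2"
    "Psi3 \<alpha> 1 2 2 (diag_point w) = w^2 * h 1 + w^3 * h 2"
    by (auto simp: g_metric_Omega[OF x] Psi2_def Psi3_def u s h_def power2_eq_square power3_eq_cube
        algebra_simps)
  have d: "det (g_metric \<alpha> (diag_point w)) = w^2 * h 0 * (h 0 + 2 * w * h 1)"
    by (simp add: det_g_metric[OF x] u s h_def power2_eq_square)
  have *: "K_G w \<alpha> = - ((w * h 0 + w^2 * h 1) * ((w * h 0 + 3 * w^2 * h 1 + w^3 * h 2) * (w^2 * h 1 + w^3 * h 2)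
       - (w^2 * h 1 + w^3 * h 2)^2)
     - w^2 * h 1 * ((w * h 0 + 3 * w^2 * h 1 + w^3 * h 2) * (w * h 0 + 3 * w^2 * h 1 + w^3 * h 2)
       - (w^2 * h 1 + w^3 * h 2) * (w^2 * h 1 + w^3 * h 2))
     + (w * h 0 + w^2 * h 1) * ((w^2 * h 1 + w^3 * h 2) * (w * h 0 + 3 * w^2 * h 1 + w^3 * h 2)
       - (w^2 * h 1 + w^3 * h 2)^2)) / (4 * (w^2 * h 0 * (h 0 + 2 * w * h 1))^2)"
    (is "_ = - ?n / _")
    using gauss_curvature_eq[OF x has_partial_Psi3_mixed[OF x] has_partial_Psi3_ex[OF x] has_partial_Psi3_ex[OF x]]
    unfolding K_G_def d by simp
  \<comment> \<open>The numerator shares the factor \<open>h 0 + 2 * w * h 1\<close> with the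
    determinant, so only one of its two powers survives in the denominator.\<close>
  have n: "?n = (w^4 * (h 0 + 2 * w * h 1)) * (h 0 * h 1 + 2 * w * h 0 * h 2 - 2 * w * (h 1)^2)"
    by algebra
  have "- ?n / (4 * (w^2 * h 0 * (h 0 + 2 * w * h 1))^2)
    = ((w^4 * (h 0 + 2 * w * h 1)) * - (h 0 * h 1 + 2 * w * h 0 * h 2 - 2 * w * (h 1)^2))
      / ((w^4 * (h 0 + 2 * w * h 1)) * (4 * (h 0)^2 * (h 0 + 2 * w * h 1)))"
    unfolding n by (rule arg_cong2[where f = "(/)"]) algebra+
  also have "\<dots> = - (h 0 * h 1 + 2 * w * h 0 * h 2 - 2 * w * (h 1)^2)
    / (4 * (h 0)^2 * (h 0 + 2 * w * h 1))"
    using w pos by (subst mult_divide_mult_cancel_left) auto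
  finally show ?thesis
    unfolding * .
qed

definition curv_num :: "real \<Rightarrow> real \<Rightarrow> real" where
  "curv_num w \<alpha> = - 128 * \<alpha>^2 * w^3 + 32 * \<alpha> * w^4 + 128 * \<alpha> * w^3 + 48 * \<alpha> * w^2 + 2 * \<alpha>
     - 16 * w^4 - 32 * w^3 - 24 * w^2 - 8 * w - 1"

text \<open>Over the common denominators \<open>P * M\<close>, its square and its cube, numerator
  and denominator both carry the fourth power of \<open>P * M\<close>, which cancels. Positivity of
  the remaining denominator makes the zeros of \<open>K_G w\<close> those of
  \<open>curv_num w\<close>.\<close>

lemma K_G_eq:
  assumes w: "0 < w" "w < 1/2" and \<alpha>: "0 \<le> \<alpha>" "\<alpha> \<le> 1"
  shows "K_G w \<alpha> = curv_num w \<alpha> / (4 * ((1 + 2 * w - 4 * \<alpha> * w)^2 * ((1 + 2 * w)^2 - 8 * \<alpha> * w)))"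
    and "0 < (1 + 2 * w - 4 * \<alpha> * w)^2 * ((1 + 2 * w)^2 - 8 * \<alpha> * w)"
proof -
  define s where "s = 2 * w"
  define P M where "P = 1 + s" and "M = 1 - s"
  have PM: "P > 0" "M > 0" "P \<noteq> 0" "M \<noteq> 0" using w by (auto simp: P_def M_def s_def)
  define n0 n1 n2 where "n0 = \<alpha> * M + (1 - \<alpha>) * P" and "n1 = - \<alpha> * M^2 + (1 - \<alpha>) * P^2"
    and "n2 = 2 * \<alpha> * M^3 + 2 * (1 - \<alpha>) * P^3"
  have h0: "hderiv \<alpha> 0 s = n0 / (P * M)"
    unfolding hderiv_def P_def[symmetric] M_def[symmetric] n0_def using PM by (simp add: field_simps)
  have h1: "hderiv \<alpha> 1 s = n1 / (P * M)^2"
    unfolding hderiv_def P_def[symmetric] M_def[symmetric] n1_def using PM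
    by (simp add: divide_simps power2_eq_square algebra_simps)
  have h2: "hderiv \<alpha> 2 s = n2 / (P * M)^3"
    unfolding hderiv_def P_def[symmetric] M_def[symmetric] n2_def using PM
    by (simp add: divide_simps)
  have h01: "hderiv \<alpha> 0 s + s * hderiv \<alpha> 1 s = (P * M * n0 + s * n1) / (P * M)^2"
    unfolding h0 h1 using PM by (simp add: power2_eq_square field_simps)
  have "0 < P * M" using PM by simp
  then have pos: "0 < n0" "0 < P * M * n0 + s * n1"
    using hderiv_pos[OF _ _ \<alpha>, of s] w unfolding h01 unfolding h0
    by (simp_all add: zero_less_divide_iff s_def)
  have n0: "n0 = 1 + 2 * w - 4 * \<alpha> * w"
    by (simp add: n0_def P_def M_def s_def algebra_simps)
  have n3: "P * M * n0 + s * n1 = (1 + 2 * w)^2 - 8 * \<alpha> * w"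
    by (simp add: n0_def n1_def P_def M_def s_def algebra_simps power2_eq_square)
  show "0 < (1 + 2 * w - 4 * \<alpha> * w)^2 * ((1 + 2 * w)^2 - 8 * \<alpha> * w)"
    using pos unfolding n3 unfolding n0 by simp
  have num: "- (P * M * n0 * n1 + s * n0 * n2 - s * n1^2) = curv_num w \<alpha>"
    unfolding n0_def n1_def n2_def P_def M_def s_def curv_num_def by algebra
  have "K_G w \<alpha> = - (n0 / (P * M) * (n1 / (P * M)^2) + s * (n0 / (P * M)) * (n2 / (P * M)^3)
      - s * (n1 / (P * M)^2)^2) / (4 * (n0 / (P * M))^2 * ((P * M * n0 + s * n1) / (P * M)^2))"
    using K_G_hderiv[OF w \<alpha>] unfolding s_def[symmetric] h01 unfolding h0 h1 h2 .
  also have "\<dots> = - (P * M * n0 * n1 + s * n0 * n2 - s * n1^2) / (4 * (n0^2 * (P * M * n0 + s * n1)))"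
  proof -
    define R where "R = P * M"
    have R: "R \<noteq> 0" using PM by (simp add: R_def)
    have "n0 / R * (n1 / R^2) + s * (n0 / R) * (n2 / R^3) - s * (n1 / R^2)^2
      = (R * n0 * n1 + s * n0 * n2 - s * n1^2) / R^4"
      using R by (simp add: divide_simps) (simp add: algebra_simps power_numeral_reduce)
    moreover have "4 * (n0 / R)^2 * ((R * n0 + s * n1) / R^2) = 4 * (n0^2 * (R * n0 + s * n1)) / R^4"
      using R by (simp add: power_divide flip: power_add)
    ultimately show ?thesis
      using R unfolding R_def[symmetric] by simp
  qed
  finally show "K_G w \<alpha> = curv_num w \<alpha> / (4 * ((1 + 2 * w - 4 * \<alpha> * w)^2 * ((1 + 2 * w)^2 - 8 * \<alpha> * w)))"
    unfolding num unfolding n3 unfolding n0 .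
qed

section \<open>The root of the curvature\<close>

text \<open>For \<open>0 < w < 1/2\<close> this is the smaller root of the quadratic
  \<open>curv_num w\<close>, since \<open>2 * w - 1\<close> is then negative.\<close>

definition alpha_formula :: "real \<Rightarrow> real" where
  "alpha_formula w = (2 * w + 1) * (8 * w^3 + 28 * w^2 - 2 * w + 1
     + (2 * w - 1) * sqrt (16 * w^4 + 56 * w^2 + 1)) / (128 * w^3)"

lemma curv_num_root:
  assumes w: "0 < w"
  shows "curv_num w (alpha_formula w) = 0"
proof -
  define r where "r = sqrt (16 * w^4 + 56 * w^2 + 1)"
  have r: "r^2 = 16 * w^4 + 56 * w^2 + 1" by (simp add: r_def)
  define a where "a = alpha_formula w"
  have a: "128 * w^3 * a = (2 * w + 1) * (8 * w^3 + 28 * w^2 - 2 * w + 1 + (2 * w - 1) * r)"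
    using w by (simp add: a_def alpha_formula_def r_def)
  \<comment> \<open>Multiplication by \<open>128 * w^3\<close> gives a quadratic in
    \<open>128 * w^3 * a\<close>, for which the formula supplies a value free of division.\<close>
  have "128 * w^3 * curv_num w a = - ((128 * w^3 * a)^2)
    + (32 * w^4 + 128 * w^3 + 48 * w^2 + 2) * (128 * w^3 * a) - 128 * w^3 * (1 + 2 * w)^4"
    by (simp add: curv_num_def) algebra
  also have "\<dots> = 0"
    unfolding a using r by algebra
  finally show ?thesis using w by (simp add: a_def)
qed

text \<open>
  Two roots of \<open>curv_num w\<close> have sum \<open>(q 1 - q 0 + c) / c\<close>, and \<open>q 1 > 0\<close> forces this above
  \<open>1 + x\<close> for a root \<open>x < 1\<close>, so the other root exceeds \<open>1\<close>.
\<close>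

lemma curv_num_root_unique:
  assumes w: "0 < w" "w < 1/2"
  shows "0 < \<alpha> \<and> \<alpha> < 1 \<and> curv_num w \<alpha> = 0 \<longleftrightarrow> \<alpha> = alpha_formula w"
proof -
  define q where "q = curv_num w"
  define c where "c = 128 * w^3"
  have c: "c > 0" using w by (simp add: c_def)
  have "q 0 = - ((1 + 2 * w)^4)"
    unfolding q_def curv_num_def by simp algebra
  then have q0: "q 0 < 0" using w by simp
  have "q 1 = (1 - 2 * w)^4"
    unfolding q_def curv_num_def by simp algebra
  then have q1: "q 1 > 0" using w by simp
  have m: "q 1 - q 0 + c = 32 * w^4 + 128 * w^3 + 48 * w^2 + 2"
    by (simp add: q_def curv_num_def c_def)
  \<comment> \<open>The difference of a quadratic with leading coefficient \<open>- c\<close> at two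
    points; \<open>q 1 - q 0 + c\<close> is its linear coefficient. Every comparison of a root with
    0, 1 or another root goes through this.\<close>
  have fac: "q x - q y = (x - y) * (q 1 - q 0 + c - c * (x + y))" for x y
    unfolding m unfolding q_def curv_num_def c_def by algebra
  define b where "b = alpha_formula w"
  have qb: "q b = 0" unfolding q_def b_def by (rule curv_num_root[OF w(1)])
  have sum: "q 1 - q 0 + c - c * (x + b) = 0" if "q x = 0" "x \<noteq> b" for x
    using fac[of x b] qb that by simp
  have less1: "q 1 - q 0 > c * x" if "q x = 0" "x < 1" for x
  proof -
    have "(1 - x) * (q 1 - q 0 + c - c * (1 + x)) > 0"
      using fac[of 1 x] that q1 by simp
    then have "q 1 - q 0 + c - c * (1 + x) > 0"
      using that(2) by (simp only: zero_less_mult_iff) simp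
    then show ?thesis by (simp add: distrib_left)
  qed
  have "b \<le> 1"
  proof -
    define r where "r = sqrt (16 * w^4 + 56 * w^2 + 1)"
    \<comment> \<open>After the factor \<open>1 - 2 * w\<close> is taken out,
      \<open>b \<le> 1\<close> becomes
      \<open>1 + 2 * w + 28 * w^2 - 8 * w^3 \<le> (1 + 2 * w) * r\<close>; the squares of the two
      sides differ by a nonnegative term.\<close>
    have "(1 + 2 * w + 28 * w^2 - 8 * w^3)^2 + 128 * w^3 * (1 - 2 * w)^2
        = (1 + 2 * w)^2 * (16 * w^4 + 56 * w^2 + 1)"
      by algebra
    then have "(1 + 2 * w + 28 * w^2 - 8 * w^3)^2 \<le> (1 + 2 * w)^2 * (16 * w^4 + 56 * w^2 + 1)"
      using w by (smt (verit) mult_nonneg_nonneg zero_le_power zero_le_power2)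
    also have "\<dots> = ((1 + 2 * w) * r)^2"
      by (simp add: r_def power_mult_distrib)
    finally have "1 + 2 * w + 28 * w^2 - 8 * w^3 \<le> (1 + 2 * w) * r"
      by (rule power2_le_imp_le) (use w in \<open>simp add: r_def\<close>)
    then have "(1 - 2 * w) * (1 + 2 * w + 28 * w^2 - 8 * w^3) \<le> (1 - 2 * w) * ((1 + 2 * w) * r)"
      by (rule mult_left_mono) (use w in simp)
    moreover have "(2 * w + 1) * (8 * w^3 + 28 * w^2 - 2 * w + 1 + (2 * w - 1) * r)
      = 128 * w^3 + ((1 - 2 * w) * (1 + 2 * w + 28 * w^2 - 8 * w^3) - (1 - 2 * w) * ((1 + 2 * w) * r))"
      by algebra
    ultimately have "(2 * w + 1) * (8 * w^3 + 28 * w^2 - 2 * w + 1 + (2 * w - 1) * r) \<le> 128 * w^3"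
      by linarith
    then show ?thesis
      using w by (simp add: b_def alpha_formula_def r_def)
  qed
  moreover have "b \<noteq> 1" using qb q1 by auto
  ultimately have b1: "b < 1" by simp
  have b0: "b > 0"
  proof -
    have "b * (q 1 - q 0 + c - c * b) > 0"
      using fac[of b 0] qb q0 by simp
    moreover have "q 1 - q 0 + c - c * b > 0"
      using less1[OF qb b1] c by simp
    ultimately show ?thesis by (simp add: zero_less_mult_iff)
  qed
  have "\<alpha> = b" if "q \<alpha> = 0" "\<alpha> < 1"
  proof (rule ccontr)
    assume "\<alpha> \<noteq> b"
    then have "c * (1 - b) < 0"
      using sum[OF that(1)] less1[OF that] by (simp add: algebra_simps)
    then show False
      using b1 c by (simp add: mult_less_0_iff)
  qed
  then show ?thesis
    using qb b0 b1 by (auto simp: q_def b_def)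
qed

lemma K_G_root_iff:
  assumes w: "0 < w" "w < 1/2"
  shows "0 < \<alpha> \<and> \<alpha> < 1 \<and> K_G w \<alpha> = 0 \<longleftrightarrow> \<alpha> = alpha_formula w"
proof -
  have "K_G w \<alpha> = 0 \<longleftrightarrow> curv_num w \<alpha> = 0" if "0 < \<alpha>" "\<alpha> < 1"
    using K_G_eq[OF w, of \<alpha>] that by (smt (verit) divide_eq_0_iff)
  then show ?thesis
    using curv_num_root_unique[OF w, of \<alpha>] by blast
qed

lemma alpha_star_eq:
  assumes "0 < w" "w < 1/2"
  shows "alpha_star w = alpha_formula w"
  unfolding alpha_star_def K_G_root_iff[OF assms] by simp

section \<open>Limit at \<open>1/2\<close> and rounded values\<close>

lemma tendsto_alpha_star: "(alpha_star \<longlongrightarrow> 1) (at_left (1/2))"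
proof -
  \<comment> \<open>The formula is continuous at \<open>1/2\<close>, where the square root term
    drops out; \<open>alpha_star\<close> is known to agree with it only to the left of that
    point.\<close>
  have "(alpha_formula \<longlongrightarrow> alpha_formula (1/2)) (at_left (1/2))"
    unfolding alpha_formula_def by (intro tendsto_intros) auto
  moreover have "alpha_formula (1/2) = 1"
    by (simp add: alpha_formula_def power_divide)
  moreover have "eventually (\<lambda>w. alpha_star w = alpha_formula w) (at_left (1/2))"
    by (rule eventually_mono[OF eventually_at_left_real[of 0 "1/2"]]) (auto simp: alpha_star_eq)
  ultimately show ?thesis
    by (simp add: tendsto_cong)
qed

lemma round_eqI:
  fixes x :: real
  assumes "real_of_int n - 1/2 < x" "x < real_of_int n + 1/2"
  shows "round x = n"
  using assms by (intro round_unique) auto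

lemma round_alpha_star:
  "round (10^4 * alpha_star (1/10)) = 8277"
  "round (10^4 * alpha_star (1/4)) = 9802"
  "round (10^4 * alpha_star (1/3)) = 9959"
proof -
  have f: "alpha_formula (1/10) = 75/8 * (136/125 - 4/5 * sqrt (976/625))"
    "alpha_formula (1/4) = 3/4 * (19/8 - 1/2 * sqrt (73/16))"
    "alpha_formula (1/3) = 45/128 * (101/27 - 1/3 * sqrt (601/81))"
    by (simp_all add: alpha_formula_def power_divide)
  \<comment> \<open>Rational brackets checked by squaring, narrow enough for rounding. The lower
    bound for \<open>sqrt (73/16)\<close> corresponds exactly to the tie 9802.5, so its strictness
    decides the second value.\<close>
  have b: "1249635 / 1000000 < sqrt (976/625)" "sqrt (976/625) < 1249645 / 1000000"
    "213600 / 100000 < sqrt (73/16)" "sqrt (73/16) < 213601 / 100000"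
    "27239 / 10000 < sqrt (601/81)" "sqrt (601/81) < 27240 / 10000"
    by (intro real_less_rsqrt real_less_lsqrt; simp add: power2_eq_square)+
  show "round (10^4 * alpha_star (1/10)) = 8277"
    by (rule round_eqI) (use b f in \<open>simp_all add: alpha_star_eq\<close>)
  show "round (10^4 * alpha_star (1/4)) = 9802"
    by (rule round_eqI) (use b f in \<open>simp_all add: alpha_star_eq\<close>)
  show "round (10^4 * alpha_star (1/3)) = 9959"
    by (rule round_eqI) (use b f in \<open>simp_all add: alpha_star_eq\<close>)
qed

theorem theorem3p4:
  shows "(\<forall>w::real. 0 < w \<and> w < 1/2 \<longrightarrow>
            (\<exists>!\<alpha>::real. 0 < \<alpha> \<and> \<alpha> < 1 \<and> K_G w \<alpha> = 0) \<and>
            alpha_star w =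
              (2 * w + 1) * (8 * w^3 + 28 * w^2 - 2 * w + 1
                + (2 * w - 1) * sqrt (16 * w^4 + 56 * w^2 + 1)) / (128 * w^3))
       \<and> (alpha_star \<longlongrightarrow> 1) (at_left (1/2))
       \<and> round (10^4 * alpha_star (1/10)) = 8277
       \<and> round (10^4 * alpha_star (1/4)) = 9802
       \<and> round (10^4 * alpha_star (1/3)) = 9959"
proof (intro conjI allI impI)
  fix w :: real
  assume w: "0 < w \<and> w < 1/2"
  then show "\<exists>!\<alpha>::real. 0 < \<alpha> \<and> \<alpha> < 1 \<and> K_G w \<alpha> = 0"
    using K_G_root_iff by auto
  show "alpha_star w = (2 * w + 1) * (8 * w^3 + 28 * w^2 - 2 * w + 1
      + (2 * w - 1) * sqrt (16 * w^4 + 56 * w^2 + 1)) / (128 * w^3)"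
    using alpha_star_eq w by (simp add: alpha_formula_def)
qed (fact tendsto_alpha_star round_alpha_star)+

end
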